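(* Let $(P_-,P_+)$ be a pair of polygons whose vertices lie on the integer lattice, i.e. $V_-,V_+\subset\mathbb{Z}^2$. Assume in addition that $P_-$ and $P_+$ together have at most three distinct tangent directions (i.e. the edges of $P_-$ and $P_+$ together are parallel to at most three distinct lines through the origin). Then every symplectic billiard orbit on the phase space $\mathcal{P}$ is periodic and there is a global bound on the period.
   Context: Polygons. Let $v_1,\dots,v_n\in\mathbb{R}^2$ be pairwise distinct (indices read cyclically) such that any two distinct open segments $v_iv_{i+1}$, $v_jv_{j+1}$ do not intersect, no open segment $v_jv_{j+1}$ contains any $v_i$, and no three consecutive $v_i,v_{i+1},v_{i+2}$ are collinear. The union $P$ of the closed segments $\overline{v_iv_{i+1}}$ is a polygon (not necessarily convex) with vertex set $V=\{v_1,\dots,v_n\}$ and (open) edges $v_iv_{i+1}$. $\mathrm{int}(P)$ is the bounded component of $\mathbb{R}^2\setminus P$. For points $a,b$, $ab$ denotes the open segment between them. For $x\in P\setminus V$, $T_xP\subset\mathbb{R}^2$ is the linear line parallel to the edge containing $x$. Pairs. $(P_-,P_+)$ is a pair of polygons (possibly equal) with vertex sets $V_-,V_+$. The notation $P_\pm,P_\mp$ indicates a choice of sign and its opposite. A pair $(x,y)\in P_\pm\times P_\mp$ satisfies condition A if $y\notin V_\mp$ and there is exactly one $z\in P_\pm\cap\{x+t: t\in T_yP_\mp, t\neq 0\}$ with $xz\subset\mathrm{int}(P_\pm)$. Let $\mathcal{P}_{\max}$ be the set of $(x,y)\in(P_-\times P_+)\sqcup(P_+\times P_-)$ satisfying condition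 A. The symplectic billiard map is $\phi:\mathcal{P}_{\max}\to(P_-\times P_+)\sqcup(P_+\times P_-)$, $\phi(x,y)=(y,z)$ with this $z$. Phase space. Let $\sigma(x,y)=(y,x)$, $N_0=(P_-\times V_+)\sqcup(P_+\times V_-)$, $N_{i+1}=\phi^{-1}(N_i)$ (preimage) for $i\ge 0$, and $N=\bigcup_{i\ge0}N_i\cup\sigma(\bigcup_{i\ge0}N_i)$. The phase space is $\mathcal{P}=\mathcal{P}_{\max}\setminus N$; $\phi$ restricts to a bijection of $\mathcal{P}$. The orbit of $(x_0,x_1)\in\mathcal{P}$ is $(\phi^k(x_0,x_1))_{k\in\mathbb{Z}}$; it is periodic if $\phi^n(x_0,x_1)=(x_0,x_1)$ for some $n\ge1$, and the least such $n$ is its period. *)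

theory Defs
  imports "HOL-Analysis.Analysis"
begin

definition vert :: "(real^2) list \<Rightarrow> nat \<Rightarrow> real^2" where
  "vert vs i = vs ! (i mod length vs)"

definition edge :: "(real^2) list \<Rightarrow> nat \<Rightarrow> (real^2) set" where
  "edge vs i = open_segment (vert vs i) (vert vs (Suc i))"

(* The bound 3 <= length vs only excludes the empty list: for one or two vertices,
   three cyclically consecutive vertices are always collinear. *)
definition polygon_vertices :: "(real^2) list \<Rightarrow> bool" where
  "polygon_vertices vs \<longleftrightarrow>
     3 \<le> length vs \<and> distinct vs \<and>
     (\<forall>i<length vs. \<forall>j<length vs. i \<noteq> j \<longrightarrow> edge vs i \<inter> edge vs j = {}) \<and>
     (\<forall>i<length vs. \<forall>j<length vs. vert vs i \<notin> edge vs j) \<and>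
     (\<forall>i<length vs. \<not> collinear {vert vs i, vert vs (Suc i), vert vs (Suc (Suc i))})"

definition polygon :: "(real^2) list \<Rightarrow> (real^2) set" where
  "polygon vs = (\<Union>i<length vs. closed_segment (vert vs i) (vert vs (Suc i)))"

definition edge_line :: "(real^2) list \<Rightarrow> nat \<Rightarrow> (real^2) set" where
  "edge_line vs i = span {vert vs (Suc i) - vert vs i}"

(* For x on the polygon but not a vertex there is exactly one such index i. *)
definition tangent_line :: "(real^2) list \<Rightarrow> real^2 \<Rightarrow> (real^2) set" where
  "tangent_line vs x = edge_line vs (THE i. i < length vs \<and> x \<in> edge vs i)"

definition tangent_directions :: "(real^2) list \<Rightarrow> (real^2) set set" where
  "tangent_directions vs = edge_line vs ` {..<length vs}"

datatype side = Side_minus | Side_plus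

fun opp :: "side \<Rightarrow> side" where
  "opp Side_minus = Side_plus"
| "opp Side_plus = Side_minus"

(* A pair of polygons is a map P from sides to vertex lists.  The triple (s, x, y) stands
   for (x, y) in P_s x P_(opp s); the tag s makes the union of the two products disjoint
   even when the two polygons coincide. *)
type_synonym point_pair = "side \<times> (real^2) \<times> (real^2)"

definition all_pairs :: "(side \<Rightarrow> (real^2) list) \<Rightarrow> point_pair set" where
  "all_pairs P = {(s, x, y). x \<in> polygon (P s) \<and> y \<in> polygon (P (opp s))}"

(* inside is the union of the bounded components of the complement; for a polygon there is
   exactly one, so this is int(P). *)
fun hits :: "(side \<Rightarrow> (real^2) list) \<Rightarrow> point_pair \<Rightarrow> real^2 \<Rightarrow> bool" where
  "hits P (s, x, y) z \<longleftrightarrow>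
     z \<in> polygon (P s) \<inter> {x + t |t. t \<in> tangent_line (P (opp s)) y \<and> t \<noteq> 0} \<and>
     open_segment x z \<subseteq> inside (polygon (P s))"

fun condition_A :: "(side \<Rightarrow> (real^2) list) \<Rightarrow> point_pair \<Rightarrow> bool" where
  "condition_A P (s, x, y) \<longleftrightarrow> y \<notin> set (P (opp s)) \<and> (\<exists>!z. hits P (s, x, y) z)"

definition P_max :: "(side \<Rightarrow> (real^2) list) \<Rightarrow> point_pair set" where
  "P_max P = {p \<in> all_pairs P. condition_A P p}"

(* Meaningful only on P_max P. *)
fun billiard_map :: "(side \<Rightarrow> (real^2) list) \<Rightarrow> point_pair \<Rightarrow> point_pair" where
  "billiard_map P (s, x, y) = (opp s, y, THE z. hits P (s, x, y) z)"

fun swap_pair :: "point_pair \<Rightarrow> point_pair" where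
  "swap_pair (s, x, y) = (opp s, y, x)"

(* The preimage is taken under the partial map with domain P_max P. *)
primrec singular :: "(side \<Rightarrow> (real^2) list) \<Rightarrow> nat \<Rightarrow> point_pair set" where
  "singular P 0 = {(s, x, y). x \<in> polygon (P s) \<and> y \<in> set (P (opp s))}"
| "singular P (Suc i) = {p \<in> P_max P. billiard_map P p \<in> singular P i}"

definition singular_set :: "(side \<Rightarrow> (real^2) list) \<Rightarrow> point_pair set" where
  "singular_set P = (\<Union>i. singular P i) \<union> swap_pair ` (\<Union>i. singular P i)"

definition phase_space :: "(side \<Rightarrow> (real^2) list) \<Rightarrow> point_pair set" where
  "phase_space P = P_max P - singular_set P"

definition periodic_orbit :: "(side \<Rightarrow> (real^2) list) \<Rightarrow> point_pair \<Rightarrow> bool" where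
  "periodic_orbit P p \<longleftrightarrow> (\<exists>n\<ge>1. (billiard_map P ^^ n) p = p)"

definition orbit_period :: "(side \<Rightarrow> (real^2) list) \<Rightarrow> point_pair \<Rightarrow> nat" where
  "orbit_period P p = (LEAST n. n \<ge> 1 \<and> (billiard_map P ^^ n) p = p)"

end

(* Let l_0, l_1, l_2 be linear functionals with l_0 + l_1 + l_2 = 0, integral on the lattice, whose
   kernels contain the (at most three) edge directions.  In a step (x, y) -> (y, z) the chord x z is
   parallel to the edge of y, so one functional takes the same value at x and z, while another one is
   an integer at z because z lies on a lattice edge of a different direction.  As the functionals sum
   to zero, all their values stay in the union of Z, t + Z and -t + Z, with t fixed along the orbit.
   So every orbit lives in a finite set of uniformly bounded size, and the map is injective: by the
   Jordan curve theorem exactly one side of an edge is interior, so a chord can be reversed. *)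
theory Submission imports Defs begin

text \<open>A pair carries two parameters: a step from \<open>(x, y)\<close> to
  \<open>(y, z)\<close> hands the parameter of \<open>x\<close> on to \<open>z\<close>, while
  \<open>y\<close> keeps its own. The finite set of an orbit is therefore built from two residue
  sets. Each parameter can be taken to be the value of a functional at a point of the polygons,
  hence it is bounded, and the number of admissible residues is bounded independently of the orbit.
  Three directions are the limit of the method: the relation between three functionals can be
  normalised to coefficients 1, so that a step changes a residue at most by a sign and an integer. A
  further direction brings relations with other coefficients, which can multiply the residue at
  every step. Finiteness alone makes orbits only eventually periodic; injectivity removes the
  preperiod. The delicate point there is that the reversed pair must again satisfy the uniqueness
  clause of condition A. It does because an interior chord is never parallel to an edge that
  contains one of its endpoints.\<close>

lemma vert_in_set: "vs \<noteq> [] \<Longrightarrow> vert vs i \<in> set vs"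
  by (simp add: vert_def)

lemma vert_mod: "vert vs (i mod length vs) = vert vs i"
  by (simp add: vert_def)

lemma set_eq_vert: "set vs = vert vs ` {..<length vs}"
  by (force simp: vert_def in_set_conv_nth)

lemma vert_neq_Suc:
  assumes "polygon_vertices vs" "i < length vs"
  shows "vert vs i \<noteq> vert vs (Suc i)"
  using assms unfolding polygon_vertices_def by (metis collinear_2 insert_absorb2)

lemma vert_eq_iff:
  assumes "polygon_vertices vs" "i < length vs" "j < length vs"
  shows "vert vs i = vert vs j \<longleftrightarrow> i = j"
  using assms by (simp add: polygon_vertices_def vert_def nth_eq_iff_index_eq)

lemma vert_notin_edge:
  assumes "polygon_vertices vs" "j < length vs"
  shows "vert vs i \<notin> edge vs j"
proof -
  have "i mod length vs < length vs"
    using assms(2) by (intro mod_less_divisor) linarith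
  then show ?thesis
    using assms unfolding polygon_vertices_def vert_mod[of vs i, symmetric] by blast
qed

lemma edge_inj:
  assumes "polygon_vertices vs" "i < length vs" "j < length vs" "x \<in> edge vs i" "x \<in> edge vs j"
  shows "i = j"
  using assms unfolding polygon_vertices_def by blast

lemma closed_segment_eq_edge:
  "closed_segment (vert vs i) (vert vs (Suc i)) = edge vs i \<union> {vert vs i, vert vs (Suc i)}"
  by (simp add: edge_def closed_segment_eq_open)

lemma edge_subset_polygon: "i < length vs \<Longrightarrow> edge vs i \<subseteq> polygon vs"
  unfolding polygon_def closed_segment_eq_edge by blast

lemma polygon_cases:
  assumes "x \<in> polygon vs" "x \<notin> set vs"
  obtains i where "i < length vs" "x \<in> edge vs i"
proof -
  obtain i where i: "i < length vs" "x \<in> edge vs i \<union> {vert vs i, vert vs (Suc i)}"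
    using assms(1) unfolding polygon_def closed_segment_eq_edge by blast
  moreover have "vs \<noteq> []"
    using i by auto
  ultimately show thesis
    using that assms(2) vert_in_set by blast
qed

lemma edge_notin_set:
  assumes "polygon_vertices vs" "i < length vs" "x \<in> edge vs i"
  shows "x \<notin> set vs"
  using assms vert_notin_edge unfolding set_eq_vert by blast

section \<open>Polygons as Jordan curves\<close>

lemma closed_segments_Int:
  assumes "polygon_vertices vs" "i < length vs" "j < length vs" "i \<noteq> j"
  shows "closed_segment (vert vs i) (vert vs (Suc i)) \<inter> closed_segment (vert vs j) (vert vs (Suc j))
    \<subseteq> {vert vs i, vert vs (Suc i)} \<inter> {vert vs j, vert vs (Suc j)}"
  using assms edge_inj[of vs i j] vert_notin_edge[of vs i] vert_notin_edge[of vs j]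
  unfolding closed_segment_eq_edge by blast

text \<open>Each appended segment meets the arc built so far only in its starting vertex, because
  its far endpoint is a new vertex. The bound \<open>Suc k < length vs\<close> excludes the closing
  edge, whose far endpoint would be \<open>vert vs 0\<close> again.\<close>

lemma polygonal_arc:
  assumes "polygon_vertices vs" "Suc k < length vs"
  shows "\<exists>g. arc g \<and> pathstart g = vert vs 0 \<and> pathfinish g = vert vs (Suc k) \<and>
    path_image g = (\<Union>i\<le>k. closed_segment (vert vs i) (vert vs (Suc i)))"
  using assms(2)
proof (induction k)
  case 0
  then have "0 < length vs"
    by linarith
  then have "vert vs 0 \<noteq> vert vs (Suc 0)"
    using vert_neq_Suc[OF assms(1)] by blast
  then show ?case
    by (intro exI[of _ "linepath (vert vs 0) (vert vs (Suc 0))"]) auto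
next
  case (Suc k)
  then obtain g where g: "arc g" "pathstart g = vert vs 0" "pathfinish g = vert vs (Suc k)"
    "path_image g = (\<Union>i\<le>k. closed_segment (vert vs i) (vert vs (Suc i)))"
    by auto
  let ?l = "linepath (vert vs (Suc k)) (vert vs (Suc (Suc k)))"
  have "arc ?l"
    using vert_neq_Suc[OF assms(1), of "Suc k"] Suc.prems by simp
  moreover have "closed_segment (vert vs i) (vert vs (Suc i)) \<inter>
      closed_segment (vert vs (Suc k)) (vert vs (Suc (Suc k))) \<subseteq> {vert vs (Suc k)}" if "i \<le> k" for i
    using closed_segments_Int[OF assms(1), of i "Suc k"] that Suc.prems
      vert_eq_iff[OF assms(1), of i "Suc (Suc k)"] vert_eq_iff[OF assms(1), of "Suc i" "Suc (Suc k)"]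
    by auto
  then have "path_image g \<inter> path_image ?l \<subseteq> {pathstart ?l}"
    unfolding g path_image_linepath pathstart_linepath by blast
  ultimately have "arc (g +++ ?l)"
    using g by (intro arc_join) auto
  moreover have "path_image (g +++ ?l) =
      (\<Union>i\<le>Suc k. closed_segment (vert vs i) (vert vs (Suc i)))"
    using g by (subst path_image_join) (auto simp: atMost_Suc)
  ultimately show ?case
    using g by (intro exI[of _ "g +++ ?l"]) auto
qed

lemma polygon_simple_loop:
  assumes "polygon_vertices vs"
  obtains g where "simple_path g" "pathfinish g = pathstart g" "path_image g = polygon vs"
proof -
  let ?n = "length vs"
  \<comment> \<open>The arc uses the edges 0 to \<open>k\<close>; the one remaining edge, with index
    \<open>Suc k\<close>, closes the loop.\<close>
  define k where "k = ?n - 2"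
  have n: "?n = Suc (Suc k)"
    using assms unfolding k_def polygon_vertices_def by linarith
  obtain g where g: "arc g" "pathstart g = vert vs 0" "pathfinish g = vert vs (Suc k)"
    "path_image g = (\<Union>i\<le>k. closed_segment (vert vs i) (vert vs (Suc i)))"
    using polygonal_arc[OF assms, of k] n by auto
  have last: "vert vs (Suc (Suc k)) = vert vs 0"
    using n by (simp add: vert_def)
  let ?l = "linepath (vert vs (Suc k)) (vert vs (Suc (Suc k)))"
  have "arc ?l"
    using vert_neq_Suc[OF assms(1), of "Suc k"] n by simp
  moreover have "closed_segment (vert vs i) (vert vs (Suc i)) \<inter>
      closed_segment (vert vs (Suc k)) (vert vs (Suc (Suc k))) \<subseteq> {vert vs 0, vert vs (Suc k)}"
    if "i \<le> k" for i
    using closed_segments_Int[OF assms(1), of i "Suc k"] that n last by auto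
  then have "path_image g \<inter> path_image ?l \<subseteq> {pathstart g, pathstart ?l}"
    unfolding g path_image_linepath pathstart_linepath by blast
  ultimately have "simple_path (g +++ ?l)"
    using g last by (intro simple_path_join_loop) auto
  moreover have "path_image (g +++ ?l) = polygon vs"
    unfolding polygon_def n lessThan_Suc_atMost using g
    by (subst path_image_join) (auto simp: atMost_Suc)
  ultimately show thesis
    using that[of "g +++ ?l"] g last by auto
qed

text \<open>The Jordan-Brouwer theorem says that every component of the complement has the whole
  curve as frontier. \<open>outside\<close> is such a component. \<open>inside\<close> is a union of
  bounded components, and a single one, \<open>C\<close>, already puts the curve into the closure of
  \<open>inside\<close>. Thus every point of the curve is a limit of inside points and of outside
  points.\<close>

lemma Jordan_frontier_inside_outside:
  fixes g :: "real \<Rightarrow> 'a::euclidean_space"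
  assumes "simple_path g" "pathfinish g = pathstart g" "DIM('a) = 2"
  shows "frontier (inside (path_image g)) = path_image g"
    and "frontier (outside (path_image g)) = path_image g"
proof -
  let ?S = "path_image g"
  have "?S homeomorphic sphere (0::complex) 1"
    using assms homeomorphic_simple_path_image_circle by fastforce
  moreover have "sphere (0::complex) 1 homeomorphic sphere (0::'a) 1"
    using assms(3) by (intro homeomorphic_spheres_gen) auto
  ultimately have hom: "?S homeomorphic sphere (0::'a) 1"
    using homeomorphic_trans by blast
  have compact: "compact ?S"
    using assms by (simp add: compact_simple_path_image)
  then have bdd: "bounded ?S"
    by (rule compact_imp_bounded)
  have "outside ?S \<in> components (- ?S)"
    using bounded_unique_outside[OF bdd, of "outside ?S"] assms(3) by simp
  then show "frontier (outside ?S) = ?S"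
    using Jordan_Brouwer_frontier[OF hom] assms(3) by simp
  have "\<not> connected (- ?S)"
    using Jordan_Brouwer_separation[OF hom] by simp
  then obtain C where C: "C \<in> components (- ?S)" "bounded C"
    using cobounded_has_bounded_component[of "- ?S"] bdd assms(3) by auto
  then have fr: "frontier C = ?S"
    using Jordan_Brouwer_frontier[OF hom] assms(3) by simp
  obtain x where x: "x \<in> - ?S" "C = connected_component_set (- ?S) x"
    using C(1) unfolding components_def by blast
  have "C \<subseteq> inside ?S"
  proof
    fix y assume "y \<in> C"
    then have "y \<in> - ?S" "connected_component_set (- ?S) y = C"
      using x(2) connected_component_in connected_component_eq by blast+
    then show "y \<in> inside ?S"
      using C(2) by (simp add: inside_def)
  qed
  then have "?S \<subseteq> closure (inside ?S)"
    using fr closure_mono[of C "inside ?S"] unfolding frontier_def by blast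
  then have "?S \<subseteq> frontier (inside ?S)"
    unfolding frontier_def using interior_subset[of "inside ?S"] inside_no_overlap[of ?S] by blast
  then show "frontier (inside ?S) = ?S"
    using frontier_inside_subset[of ?S] compact compact_imp_closed by blast
qed

lemma polygon_topology:
  assumes "polygon_vertices vs"
  shows "compact (polygon vs)"
    and "frontier (inside (polygon vs)) = polygon vs"
    and "frontier (outside (polygon vs)) = polygon vs"
proof -
  obtain g where g: "simple_path g" "pathfinish g = pathstart g" "path_image g = polygon vs"
    using polygon_simple_loop[OF assms] .
  then show "compact (polygon vs)"
    using compact_simple_path_image by metis
  show "frontier (inside (polygon vs)) = polygon vs" "frontier (outside (polygon vs)) = polygon vs"
    using Jordan_frontier_inside_outside[OF g(1,2)] g(3) by simp_all
qed

subsection \<open>Chords of a polygon\<close>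

text \<open>As a function of \<open>p\<close> this is a linear functional whose kernel is the line
  spanned by \<open>u\<close> (if \<open>u\<close> is nonzero), and it is integral on the lattice if
  \<open>u\<close> is. The functionals of the proof are multiples of it.\<close>

definition det2 :: "real^2 \<Rightarrow> real^2 \<Rightarrow> real" where
  "det2 u p = u $ 1 * p $ 2 - u $ 2 * p $ 1"

lemma linear_det2: "linear (det2 u)"
  by (intro linearI) (simp_all add: det2_def algebra_simps)

lemma det2_add: "det2 u (p + q) = det2 u p + det2 u q"
  and det2_scaleR: "det2 u (c *\<^sub>R p) = c * det2 u p"
  by (simp_all add: det2_def algebra_simps)

lemma det2_eq_inner: "det2 u p = vector [- (u $ 2), u $ 1] \<bullet> p"
  by (simp add: det2_def inner_vec_def sum_2)

lemma span_eq_det2: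
  assumes "u \<noteq> 0"
  shows "span {u} = {p. det2 u p = 0}"
proof
  show "span {u} \<subseteq> {p. det2 u p = 0}"
    by (auto simp: span_singleton det2_def)
  show "{p. det2 u p = 0} \<subseteq> span {u}"
  proof
    fix p assume p: "p \<in> {p. det2 u p = 0}"
    \<comment> \<open>The coefficient of the orthogonal projection onto \<open>u\<close>; the
      vanishing determinant makes \<open>p\<close> equal to its projection.\<close>
    let ?c = "(u \<bullet> p) / (u \<bullet> u)"
    have "(u \<bullet> u) *\<^sub>R p = (u \<bullet> p) *\<^sub>R u"
    proof -
      have "u $ 2 * p $ 1 = u $ 1 * p $ 2"
        using p by (simp add: det2_def)
      then have "(u $ 1 * u $ 1 + u $ 2 * u $ 2) * p $ 1 = (u $ 1 * p $ 1 + u $ 2 * p $ 2) * u $ 1"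
        "(u $ 1 * u $ 1 + u $ 2 * u $ 2) * p $ 2 = (u $ 1 * p $ 1 + u $ 2 * p $ 2) * u $ 2"
        by algebra+
      then show ?thesis
        by (simp add: vec_eq_iff forall_2 inner_vec_def sum_2)
    qed
    then have "p = ?c *\<^sub>R u"
      using assms by (metis inner_eq_zero_iff vector_fraction_eq_iff)
    then show "p \<in> span {u}"
      by (metis span_base span_scale singletonI)
  qed
qed

lemma edge_line_eq_det2:
  assumes "polygon_vertices vs" "i < length vs"
  shows "edge_line vs i = {p. det2 (vert vs (Suc i) - vert vs i) p = 0}"
  unfolding edge_line_def using vert_neq_Suc[OF assms] by (intro span_eq_det2) simp

lemma edge_diff_in_edge_line:
  assumes "x \<in> closed_segment (vert vs i) (vert vs (Suc i))"
    "y \<in> closed_segment (vert vs i) (vert vs (Suc i))"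
  shows "x - y \<in> edge_line vs i"
proof -
  obtain a b where ab: "x = (1 - a) *\<^sub>R vert vs i + a *\<^sub>R vert vs (Suc i)"
    "y = (1 - b) *\<^sub>R vert vs i + b *\<^sub>R vert vs (Suc i)"
    using assms unfolding in_segment by blast
  have "x - y = (a - b) *\<^sub>R (vert vs (Suc i) - vert vs i)"
    unfolding ab by (simp add: algebra_simps)
  then show ?thesis
    unfolding edge_line_def by (metis span_base span_scale singletonI)
qed

section \<open>Local sides of an edge and interior chords\<close>

lemma connected_subset_inside_or_outside:
  fixes S :: "'a::real_normed_vector set"
  assumes "closed S" "connected H" "H \<inter> S = {}"
  shows "H \<subseteq> inside S \<or> H \<subseteq> outside S"
proof -
  have "H \<subseteq> inside S \<union> outside S"
    using assms(3) by (simp add: disjoint_eq_subset_Compl)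
  moreover have "inside S \<inter> H = {} \<or> outside S \<inter> H = {}"
    using calculation connectedD[OF assms(2) open_inside[OF assms(1)] open_outside[OF assms(1)]]
    by simp
  ultimately show ?thesis
    by blast
qed

lemma open_meets_complement_hyperplane:
  fixes a :: "'a::euclidean_space"
  assumes "open U" "U \<noteq> {}" "a \<noteq> 0"
  obtains p where "p \<in> U" "a \<bullet> p \<noteq> b"
proof -
  have "\<not> U \<subseteq> {p. a \<bullet> p = b}"
    using assms interior_maximal[of U "{p. a \<bullet> p = b}"] by auto
  then show thesis
    using that by blast
qed

text \<open>Near \<open>x\<close> the polygon is contained in the line of its edge, so each of the
  two open half balls cut off by this line lies entirely inside or entirely outside. Both regions
  accumulate at \<open>x\<close>, and neither can stay on the line, so both occur, one on each
  side.\<close>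

lemma edge_sides:
  assumes "polygon_vertices vs" "i < length vs" "x \<in> edge vs i" "d \<notin> edge_line vs i"
  obtains \<epsilon> \<sigma> where "\<epsilon> > 0" "\<sigma> \<in> {1, -1 :: real}"
    "\<And>t. 0 < t \<Longrightarrow> t < \<epsilon> \<Longrightarrow> x + (\<sigma> * t) *\<^sub>R d \<in> inside (polygon vs)"
    "\<And>t. 0 < t \<Longrightarrow> t < \<epsilon> \<Longrightarrow> x - (\<sigma> * t) *\<^sub>R d \<in> outside (polygon vs)"
proof -
  let ?P = "polygon vs"
  let ?u = "vert vs (Suc i) - vert vs i"
  define a :: "real^2" where "a = vector [- (?u $ 2), ?u $ 1]"
  have line: "edge_line vs i = {p. a \<bullet> p = 0}"
    using edge_line_eq_det2[OF assms(1,2)] by (simp add: det2_eq_inner a_def)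
  have ad: "a \<bullet> d \<noteq> 0"
    using assms(4) line by simp
  then have a: "a \<noteq> 0" and d: "d \<noteq> 0"
    by auto
  \<comment> \<open>The other edges form a closed set without \<open>x\<close>; a ball around
    \<open>x\<close> that avoids them meets the polygon only in the edge \<open>i\<close>.\<close>
  define K where "K = (\<Union>j\<in>{..<length vs} - {i}. closed_segment (vert vs j) (vert vs (Suc j)))"
  have "closed K"
    unfolding K_def by (intro closed_UN) auto
  moreover have "x \<notin> K"
  proof
    assume "x \<in> K"
    then obtain j where "j < length vs" "j \<noteq> i" "x \<in> edge vs j \<union> {vert vs j, vert vs (Suc j)}"
      unfolding K_def closed_segment_eq_edge by blast
    then show False
      using assms(3) edge_inj[OF assms(1,2), of j x] vert_notin_edge[OF assms(1,2)] by blast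
  qed
  ultimately obtain e where "e > 0" "ball x e \<subseteq> - K"
    by (meson openE open_Compl ComplI)
  then have e: "e > 0" "ball x e \<inter> K = {}"
    by blast+
  have x: "x \<in> closed_segment (vert vs i) (vert vs (Suc i))"
    using assms(3) by (simp add: closed_segment_eq_edge)
  have P_ball: "a \<bullet> p = a \<bullet> x" if "p \<in> ?P" "p \<in> ball x e" for p
  proof -
    have "p \<in> closed_segment (vert vs i) (vert vs (Suc i))"
      using that e unfolding polygon_def K_def by blast
    then show ?thesis
      using edge_diff_in_edge_line[OF _ x] line by (simp add: inner_diff_right)
  qed
  define H where "H = (\<lambda>s::real. ball x e \<inter> {p. s * (a \<bullet> p) > s * (a \<bullet> x)})"
  have H: "H s \<subseteq> inside ?P \<or> H s \<subseteq> outside ?P" for s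
  proof (rule connected_subset_inside_or_outside)
    show "closed ?P"
      using polygon_topology(1)[OF assms(1)] compact_imp_closed by blast
    have "convex {p. (s *\<^sub>R a) \<bullet> p > s * (a \<bullet> x)}"
      by (rule convex_halfspace_gt)
    then show "connected (H s)"
      unfolding H_def by (intro convex_connected convex_Int) auto
    show "H s \<inter> ?P = {}"
      unfolding H_def using P_ball by fastforce
  qed
  have "x \<in> ?P"
    using assms edge_subset_polygon by blast
  then have cl: "x \<in> closure (inside ?P)" "x \<in> closure (outside ?P)"
    using polygon_topology(2,3)[OF assms(1)] unfolding frontier_def by blast+
  \<comment> \<open>An open set near x cannot lie entirely on the line through the edge.\<close>
  have meet: "U \<inter> (H 1 \<union> H (-1)) \<noteq> {}" if U: "open U" "x \<in> closure U" for U
  proof -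
    have "x \<in> ball x e \<inter> closure U"
      using U e(1) by simp
    then have "ball x e \<inter> U \<noteq> {}"
      using open_Int_closure_eq_empty[OF open_ball, of x e U] by blast
    moreover have "open (ball x e \<inter> U)"
      using U by blast
    ultimately obtain p where "p \<in> ball x e \<inter> U" "a \<bullet> p \<noteq> a \<bullet> x"
      using open_meets_complement_hyperplane[of "ball x e \<inter> U" a "a \<bullet> x"] a by metis
    then have "p \<in> U" "p \<in> H 1 \<or> p \<in> H (-1)"
      unfolding H_def by auto
    then show ?thesis
      by blast
  qed
  have "closed ?P"
    using polygon_topology(1)[OF assms(1)] compact_imp_closed by blast
  then have meets: "inside ?P \<inter> (H 1 \<union> H (-1)) \<noteq> {}" "outside ?P \<inter> (H 1 \<union> H (-1)) \<noteq> {}"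
    using meet cl open_inside open_outside by blast+
  obtain s :: real where s: "s \<in> {1, -1}" "H s \<subseteq> inside ?P" "H (- s) \<subseteq> outside ?P"
  proof -
    have "H 1 \<subseteq> inside ?P \<and> H (-1) \<subseteq> outside ?P \<or> H (-1) \<subseteq> inside ?P \<and> H 1 \<subseteq> outside ?P"
      using H[of 1] H[of "-1"] inside_Int_outside[of ?P] meets by blast
    then show thesis
      using that[of 1] that[of "-1"] by auto
  qed
  \<comment> \<open>\<open>s\<close> tells on which side of the line the interior lies; the sign of
    \<open>a \<bullet> d\<close> translates this into a direction along \<open>d\<close>.\<close>
  define \<sigma> where "\<sigma> = s * sgn (a \<bullet> d)"
  have \<sigma>: "\<sigma> \<in> {1, -1}" "s * \<sigma> * (a \<bullet> d) > 0"
    using s(1) ad by (auto simp: \<sigma>_def sgn_if)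
  \<comment> \<open>One computation for both half balls: \<open>r = 1\<close> gives the inner one,
    \<open>r = -1\<close> the outer one.\<close>
  have in_H: "x + (r * \<sigma> * t) *\<^sub>R d \<in> H (r * s)"
    if "0 < t" "t < e / norm d" "r \<in> {1, -1}" for t r
  proof -
    have "\<bar>r * \<sigma> * t\<bar> * norm d < e"
    proof -
      have "\<bar>r * \<sigma> * t\<bar> = t"
        using that(1,3) \<sigma>(1) by auto
      then show ?thesis
        using that(2) d by (simp add: pos_less_divide_eq)
    qed
    then have inb: "x + (r * \<sigma> * t) *\<^sub>R d \<in> ball x e"
      by (simp add: dist_norm)
    have "(s * \<sigma> * (a \<bullet> d)) * t > 0"
      using \<sigma>(2) that(1) by simp
    moreover have "(r * s) * (a \<bullet> (x + (r * \<sigma> * t) *\<^sub>R d)) =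
        (r * s) * (a \<bullet> x) + (r * r) * ((s * \<sigma> * (a \<bullet> d)) * t)"
      by (simp add: inner_add_right algebra_simps)
    moreover have "r * r = 1"
      using that(3) by auto
    ultimately have "(r * s) * (a \<bullet> (x + (r * \<sigma> * t) *\<^sub>R d)) > (r * s) * (a \<bullet> x)"
      by simp
    with inb show ?thesis
      unfolding H_def by blast
  qed
  show thesis
  proof
    show "e / norm d > 0"
      using e d by simp
    show "\<sigma> \<in> {1, -1}"
      by (rule \<sigma>)
    fix t assume t: "0 < t" "t < e / norm d"
    show "x + (\<sigma> * t) *\<^sub>R d \<in> inside ?P"
      using in_H[OF t, of 1] s(2) by auto
    show "x - (\<sigma> * t) *\<^sub>R d \<in> outside ?P"
      using in_H[OF t, of "-1"] s(3) by auto
  qed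
qed

lemma mem_open_segment_ray:
  assumes "0 < r" "r < (1::real)"
  shows "x + (r * t) *\<^sub>R d \<in> open_segment x (x + t *\<^sub>R d) \<longleftrightarrow> t *\<^sub>R d \<noteq> 0"
proof -
  have "x + (r * t) *\<^sub>R d = (1 - r) *\<^sub>R x + r *\<^sub>R (x + t *\<^sub>R d)"
    by (simp add: algebra_simps)
  then show ?thesis
    using assms unfolding in_segment by (metis add_0_right add_left_cancel)
qed

text \<open>The chord follows the ray on the interior side up to its first exit. In the opposite
  direction a chord would begin outside; a shorter chord would end at an inside point, and a longer
  one would contain the exit point, which lies on the polygon. Hence the uniqueness clause of
  condition A is automatic at an edge point when the direction is transversal.\<close>

lemma unique_chord:
  assumes "polygon_vertices vs" "i < length vs" "x \<in> edge vs i" "d \<notin> edge_line vs i"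
  shows "\<exists>!z. z \<in> polygon vs \<inter> {x + t |t. t \<in> span {d} \<and> t \<noteq> 0} \<and>
    open_segment x z \<subseteq> inside (polygon vs)"
proof -
  let ?P = "polygon vs"
  have "d \<noteq> 0"
    using assms(4) by (auto simp: edge_line_def span_zero)
  obtain \<epsilon> \<sigma> where \<epsilon>: "\<epsilon> > 0" and \<sigma>: "\<sigma> \<in> {1, -1 :: real}"
    and ins: "\<And>t. 0 < t \<Longrightarrow> t < \<epsilon> \<Longrightarrow> x + (\<sigma> * t) *\<^sub>R d \<in> inside ?P"
    and outs: "\<And>t. 0 < t \<Longrightarrow> t < \<epsilon> \<Longrightarrow> x - (\<sigma> * t) *\<^sub>R d \<in> outside ?P"
    using edge_sides[OF assms] by metis
  have cl: "closed ?P"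
    using polygon_topology(1)[OF assms(1)] compact_imp_closed by blast
  let ?l = "\<sigma> *\<^sub>R d"
  \<comment> \<open>\<open>ray_to_frontier\<close> needs a start in the interior, and
    \<open>x\<close> itself is on the frontier. The shift by \<open>\<epsilon>/2\<close> is added
    back in the length \<open>R\<close>.\<close>
  let ?a = "x + (\<epsilon>/2) *\<^sub>R ?l"
  have "?a \<in> inside ?P"
    using ins[of "\<epsilon>/2"] \<epsilon> by (simp add: mult.commute)
  then have "?a \<in> interior (inside ?P)"
    using open_inside[OF cl] interior_open by blast
  moreover have "bounded (inside ?P)"
    using polygon_topology(1)[OF assms(1)] compact_imp_bounded bounded_inside by blast
  moreover have "?l \<noteq> 0"
    using \<sigma> \<open>d \<noteq> 0\<close> by auto
  ultimately obtain T where T: "T > 0" "?a + T *\<^sub>R ?l \<in> frontier (inside ?P)"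
    "\<And>e. 0 \<le> e \<Longrightarrow> e < T \<Longrightarrow> ?a + e *\<^sub>R ?l \<in> interior (inside ?P)"
    using ray_to_frontier by metis
  define R where "R = \<epsilon>/2 + T"
  have R: "R > 0" "x + (\<sigma> * R) *\<^sub>R d \<in> ?P"
    using T \<epsilon> polygon_topology(2)[OF assms(1)] by (simp_all add: R_def algebra_simps)
  have between: "x + (\<sigma> * t) *\<^sub>R d \<in> inside ?P" if "0 < t" "t < R" for t
  proof (cases "t < \<epsilon>")
    case False
    then have "?a + (t - \<epsilon>/2) *\<^sub>R ?l \<in> inside ?P"
      using T(3)[of "t - \<epsilon>/2"] \<epsilon> that interior_subset unfolding R_def by fastforce
    then show ?thesis
      by (simp add: algebra_simps)
  qed (use ins that in auto)
  show ?thesis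
  proof (rule ex1I[of _ "x + (\<sigma> * R) *\<^sub>R d"])
    have "(\<sigma> * R) *\<^sub>R d \<in> span {d}"
      by (simp add: span_base span_scale)
    moreover have "(\<sigma> * R) *\<^sub>R d \<noteq> 0"
      using \<sigma> R \<open>d \<noteq> 0\<close> by auto
    moreover have "open_segment x (x + (\<sigma> * R) *\<^sub>R d) \<subseteq> inside ?P"
    proof
      fix p assume "p \<in> open_segment x (x + (\<sigma> * R) *\<^sub>R d)"
      then obtain r where "0 < r" "r < 1" "p = (1 - r) *\<^sub>R x + r *\<^sub>R (x + (\<sigma> * R) *\<^sub>R d)"
        unfolding in_segment by blast
      then have r: "0 < r" "r < 1" "p = x + (\<sigma> * (r * R)) *\<^sub>R d"
        by (auto simp: algebra_simps)
      show "p \<in> inside ?P"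
        unfolding r(3) using r(1,2) R(1) by (intro between) auto
    qed
    ultimately show "x + (\<sigma> * R) *\<^sub>R d \<in> ?P \<inter> {x + t |t. t \<in> span {d} \<and> t \<noteq> 0} \<and>
        open_segment x (x + (\<sigma> * R) *\<^sub>R d) \<subseteq> inside ?P"
      using R(2) by blast
  next
    fix z assume z: "z \<in> ?P \<inter> {x + t |t. t \<in> span {d} \<and> t \<noteq> 0} \<and> open_segment x z \<subseteq> inside ?P"
    then obtain c where c: "z = x + c *\<^sub>R d" "c *\<^sub>R d \<noteq> 0"
      unfolding span_singleton by auto
    define t where "t = \<sigma> * c"
    have zt: "z = x + (\<sigma> * t) *\<^sub>R d" "t \<noteq> 0"
      using c \<sigma> by (auto simp: t_def)
    have seg: "x + (\<sigma> * (r * t)) *\<^sub>R d \<in> inside ?P" if "0 < r" "r < 1" for r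
      using that mem_open_segment_ray[of r x "\<sigma> * t" d] z zt c by (auto simp: mult.left_commute)
    have "t > 0"
    proof (rule ccontr)
      assume "\<not> t > 0"
      then have neg: "t < 0"
        using zt(2) by simp
      \<comment> \<open>Small enough that the point at parameter \<open>r * t\<close> is within
        \<open>\<epsilon>\<close> of parameter 0, where \<open>outs\<close> applies; the cap 1/2
        keeps it in the open segment.\<close>
      define r where "r = min (1/2) (\<epsilon> / (2 * - t))"
      have r: "0 < r" "r < 1" and "r \<le> \<epsilon> / (2 * - t)"
        using \<epsilon> neg by (auto simp: r_def divide_pos_neg)
      then have "r * - t \<le> \<epsilon> / 2"
        using neg by (simp add: field_simps)
      then have "x - (\<sigma> * (r * - t)) *\<^sub>R d \<in> outside ?P"
        using r neg \<epsilon> by (intro outs) (auto simp: mult_pos_neg)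
      moreover have "x - (\<sigma> * (r * - t)) *\<^sub>R d \<in> inside ?P"
        using seg[OF r] by simp
      ultimately show False
        using inside_Int_outside by blast
    qed
    have "\<not> t < R"
      using between[OF \<open>t > 0\<close>] zt(1) z inside_no_overlap by blast
    moreover have "\<not> R < t"
    proof
      assume "R < t"
      then have "x + (\<sigma> * (R / t * t)) *\<^sub>R d \<in> inside ?P"
        using R(1) by (intro seg) auto
      then show False
        using R(2) \<open>t > 0\<close> inside_no_overlap by fastforce
    qed
    ultimately show "z = x + (\<sigma> * R) *\<^sub>R d"
      using zt(1) by simp
  qed
qed

text \<open>A chord parallel to the edge of its endpoint \<open>z\<close> would run inside that edge
  near \<open>z\<close>, so it would contain polygon points, although its points lie in the
  interior.\<close>

lemma chord_transversal:
  assumes "polygon_vertices vs" "i < length vs" "z \<in> edge vs i" "x \<noteq> z"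
    and "open_segment x z \<subseteq> inside (polygon vs)"
  shows "x - z \<notin> edge_line vs i"
proof
  let ?v = "vert vs i" and ?w = "vert vs (Suc i)"
  assume "x - z \<in> edge_line vs i"
  then obtain c where "x - z = c *\<^sub>R (?w - ?v)"
    unfolding edge_line_def span_singleton by blast
  then have x: "x = z + c *\<^sub>R (?w - ?v)"
    by (simp add: algebra_simps)
  obtain u where u: "0 < u" "u < 1" "z = (1 - u) *\<^sub>R ?v + u *\<^sub>R ?w"
    using assms(3) unfolding edge_def in_segment by blast
  have vw: "?v \<noteq> ?w"
    using vert_neq_Suc[OF assms(1,2)] .
  \<comment> \<open>\<open>m\<close> is the room that the parameter of \<open>z\<close> has inside
    (0, 1). Dividing by \<open>\<bar>c\<bar> + 1\<close> makes \<open>s\<close> less than 1 and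
    \<open>s * \<bar>c\<bar>\<close> strictly less than \<open>m\<close>.\<close>
  define m where "m = min u (1 - u)"
  have m: "0 < m" "m < 1" "m \<le> u" "m \<le> 1 - u"
    using u by (auto simp: m_def)
  define s where "s = m / (\<bar>c\<bar> + 1)"
  have c1: "\<bar>c\<bar> + 1 > 0"
    by linarith
  then have s: "0 < s" "s < 1"
    using m(1,2) by (auto simp: s_def pos_divide_less_eq)
  have "s * (\<bar>c\<bar> + 1) = m"
    using c1 by (simp add: s_def)
  then have sm: "s * \<bar>c\<bar> + s = m"
    by (simp add: algebra_simps)
  have "\<bar>s * c\<bar> < m"
    using s(1) sm by (simp add: abs_mult)
  then have sc: "0 < u + s * c" "u + s * c < 1"
    using m by linarith+
  have "z + (s * c) *\<^sub>R (?w - ?v) = (1 - (u + s * c)) *\<^sub>R ?v + (u + s * c) *\<^sub>R ?w"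
    unfolding u(3) by (simp add: algebra_simps)
  then have "z + (s * c) *\<^sub>R (?w - ?v) \<in> edge vs i"
    using sc vw unfolding edge_def in_segment by blast
  then have "z + (s * c) *\<^sub>R (?w - ?v) \<in> polygon vs"
    using edge_subset_polygon[OF assms(2)] by blast
  moreover have "z + (s * c) *\<^sub>R (?w - ?v) \<in> open_segment x z"
    using mem_open_segment_ray[OF s, of z c "?w - ?v"] assms(4) x
    by (auto simp: open_segment_commute)
  ultimately show False
    using assms(5) inside_no_overlap by blast
qed

lemma span_singleton_eqI:
  fixes u v :: "'a::real_vector"
  assumes "v \<in> span {u}" "v \<noteq> 0"
  shows "span {v} = span {u}"
proof
  obtain c where c: "v = c *\<^sub>R u"
    using assms(1) unfolding span_singleton by blast
  then have "u = inverse c *\<^sub>R v"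
    using assms(2) by auto
  moreover have "inverse c *\<^sub>R v \<in> span {v}"
    by (intro span_scale span_base) simp
  ultimately have "u \<in> span {v}"
    by metis
  then show "span {u} \<subseteq> span {v}"
    by (simp add: span_minimal)
  show "span {v} \<subseteq> span {u}"
    using assms(1) by (simp add: span_minimal)
qed

lemma tangent_line_eq:
  assumes "polygon_vertices vs" "i < length vs" "x \<in> edge vs i"
  shows "tangent_line vs x = edge_line vs i"
proof -
  have "(THE i. i < length vs \<and> x \<in> edge vs i) = i"
    using assms edge_inj[OF assms(1)] by (intro the_equality) auto
  then show ?thesis
    by (simp add: tangent_line_def)
qed

lemma opp_opp [simp]: "opp (opp s) = s"
  by (cases s) auto

lemma opp_eq_iff [simp]: "opp s = opp s' \<longleftrightarrow> s = s'"
  by (metis opp_opp)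

subsection \<open>Reversibility of the billiard map\<close>

declare hits.simps [simp del] billiard_map.simps [simp del]

locale polygon_pair =
  fixes P :: "side \<Rightarrow> (real^2) list"
  assumes polygons: "\<And>s. polygon_vertices (P s)"
begin

lemma ex1_hits:
  assumes "i < length (P s)" "x \<in> edge (P s) i" "j < length (P (opp s))" "y \<in> edge (P (opp s)) j"
    and "edge_line (P s) i \<noteq> edge_line (P (opp s)) j"
  shows "\<exists>!z. hits P (s, x, y) z"
proof -
  let ?d = "vert (P (opp s)) (Suc j) - vert (P (opp s)) j"
  have "?d \<noteq> 0"
    using vert_neq_Suc[OF polygons assms(3)] by simp
  then have "?d \<notin> edge_line (P s) i"
    using assms(5) span_singleton_eqI unfolding edge_line_def by metis
  then show ?thesis
    using unique_chord[OF polygons assms(1,2)] tangent_line_eq[OF polygons assms(3,4)]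
    by (simp add: edge_line_def hits.simps)
qed

lemma billiard_map_eq:
  assumes "\<exists>!z. hits P (s, x, y) z" "hits P (s, x, y) z"
  shows "billiard_map P (s, x, y) = (opp s, y, z)"
  using assms by (simp add: billiard_map.simps the1_equality)

lemma hits_commute:
  assumes "hits P (s, x, y) z" "x \<in> polygon (P s)"
  shows "hits P (s, z, y) x"
proof -
  obtain t where t: "z = x + t" "t \<in> tangent_line (P (opp s)) y" "t \<noteq> 0"
    using assms(1) by (auto simp: hits.simps)
  then have "x = z + - t" "- t \<in> tangent_line (P (opp s)) y" "- t \<noteq> 0"
    by (auto simp: tangent_line_def edge_line_def span_neg)
  then have "x \<in> {z + t |t. t \<in> tangent_line (P (opp s)) y \<and> t \<noteq> 0}"
    by blast
  then show ?thesis
    using assms by (simp add: hits.simps open_segment_commute)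
qed

text \<open>Both halves of \<open>singular_set\<close> enter: removing the swap of
  \<open>singular P 0\<close> keeps \<open>x\<close> off the vertices, and removing
  \<open>singular P (Suc 0)\<close> keeps \<open>z\<close> off them. The edges of \<open>y\<close>
  and \<open>z\<close> have different directions because the chord is parallel to the first and
  transversal to the second.\<close>

lemma phase_space_step:
  assumes "(s, x, y) \<in> phase_space P"
  obtains i j k z where "i < length (P s)" "x \<in> edge (P s) i"
    "j < length (P (opp s))" "y \<in> edge (P (opp s)) j"
    "k < length (P s)" "z \<in> edge (P s) k"
    "hits P (s, x, y) z" "billiard_map P (s, x, y) = (opp s, y, z)"
    "z - x \<in> edge_line (P (opp s)) j" "edge_line (P s) k \<noteq> edge_line (P (opp s)) j"
proof -
  have max: "(s, x, y) \<in> P_max P" and nsing: "(s, x, y) \<notin> singular_set P"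
    using assms by (auto simp: phase_space_def)
  then have xy: "x \<in> polygon (P s)" "y \<in> polygon (P (opp s))" "y \<notin> set (P (opp s))"
    and ex1: "\<exists>!z. hits P (s, x, y) z"
    by (auto simp: P_max_def all_pairs_def)
  obtain z where z: "hits P (s, x, y) z"
    using ex1 by blast
  note map = billiard_map_eq[OF ex1 z]
  have x_notin: "x \<notin> set (P s)"
  proof
    assume "x \<in> set (P s)"
    then have "(opp s, y, x) \<in> singular P 0"
      using xy by simp
    then have "swap_pair (opp s, y, x) \<in> singular_set P"
      unfolding singular_set_def by blast
    then show False
      using nsing by simp
  qed
  have z_notin: "z \<notin> set (P s)"
  proof
    assume "z \<in> set (P s)"
    then have "billiard_map P (s, x, y) \<in> singular P 0"
      using xy map by simp
    then have "(s, x, y) \<in> singular P (Suc 0)"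
      using max by simp
    then show False
      using nsing unfolding singular_set_def by blast
  qed
  have z_in: "z \<in> polygon (P s)"
    using z by (simp add: hits.simps)
  obtain i where i: "i < length (P s)" "x \<in> edge (P s) i"
    using polygon_cases[OF xy(1) x_notin] .
  obtain j where j: "j < length (P (opp s))" "y \<in> edge (P (opp s)) j"
    using polygon_cases[OF xy(2,3)] .
  obtain k where k: "k < length (P s)" "z \<in> edge (P s) k"
    using polygon_cases[OF z_in z_notin] .
  have dir: "z - x \<in> edge_line (P (opp s)) j" "x \<noteq> z"
    using z tangent_line_eq[OF polygons j] by (auto simp: hits.simps)
  have "x - z \<notin> edge_line (P s) k"
    using chord_transversal[OF polygons k dir(2)] z by (simp add: hits.simps)
  moreover have "x - z \<in> edge_line (P (opp s)) j"
    using dir(1) span_neg[of "z - x"] unfolding edge_line_def by simp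
  ultimately have "edge_line (P s) k \<noteq> edge_line (P (opp s)) j"
    by blast
  then show thesis
    using that[OF i j k z map dir(1)] by blast
qed

text \<open>This is reversibility: conjugating the map with \<open>swap_pair\<close> inverts it. The
  reversed chord is a hit by symmetry, and it is the only one because the directions at
  \<open>z\<close> and \<open>y\<close> differ; \<open>(s, z, y)\<close> is not assumed to lie in
  the phase space.\<close>

lemma billiard_map_reverse:
  assumes "(s, x, y) \<in> phase_space P" "billiard_map P (s, x, y) = (opp s, y, z)"
  shows "billiard_map P (s, z, y) = (opp s, y, x)"
proof -
  obtain i j k z' where ijk: "i < length (P s)" "x \<in> edge (P s) i"
    "j < length (P (opp s))" "y \<in> edge (P (opp s)) j" "k < length (P s)" "z' \<in> edge (P s) k"
    and hits': "hits P (s, x, y) z'" and map: "billiard_map P (s, x, y) = (opp s, y, z')"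
    and "z' - x \<in> edge_line (P (opp s)) j"
    and ne: "edge_line (P s) k \<noteq> edge_line (P (opp s)) j"
    by (rule phase_space_step[OF assms(1)])
  have "z' = z"
    using assms(2) map by (metis prod.inject)
  note ijk = ijk[unfolded this] and hits = hits'[unfolded this]
  have "\<exists>!w. hits P (s, z, y) w"
    using ex1_hits ijk ne by blast
  moreover have "x \<in> polygon (P s)"
    using ijk edge_subset_polygon by blast
  ultimately show ?thesis
    using billiard_map_eq hits_commute[OF hits] by blast
qed

lemma billiard_map_phase_space:
  assumes "p \<in> phase_space P"
  shows "billiard_map P p \<in> phase_space P"
proof -
  obtain s x y where p: "p = (s, x, y)"
    by (cases p)
  obtain i j k z where ijk: "i < length (P s)" "x \<in> edge (P s) i"
    "j < length (P (opp s))" "y \<in> edge (P (opp s)) j" "k < length (P s)" "z \<in> edge (P s) k"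
    and "hits P (s, x, y) z" and map: "billiard_map P (s, x, y) = (opp s, y, z)"
    and "z - x \<in> edge_line (P (opp s)) j"
    and ne: "edge_line (P s) k \<noteq> edge_line (P (opp s)) j"
    by (rule phase_space_step[OF assms[unfolded p]])
  have "\<exists>!w. hits P (opp s, y, z) w"
    using ex1_hits[of j "opp s" y k z] ijk ne by simp
  moreover have notin: "y \<notin> set (P (opp s))" "z \<notin> set (P s)"
    using edge_notin_set[OF polygons] ijk by blast+
  moreover have "y \<in> polygon (P (opp s))" "z \<in> polygon (P s)"
    using ijk edge_subset_polygon by blast+
  ultimately have max: "(opp s, y, z) \<in> P_max P"
    by (simp add: P_max_def all_pairs_def)
  have max0: "(s, x, y) \<in> P_max P" and nsing: "(s, x, y) \<notin> singular_set P"
    using assms unfolding p by (auto simp: phase_space_def)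
  have "(opp s, y, z) \<notin> singular P n" for n
  proof
    assume "(opp s, y, z) \<in> singular P n"
    then have "(s, x, y) \<in> singular P (Suc n)"
      using max0 map by simp
    then show False
      using nsing unfolding singular_set_def by blast
  qed
  \<comment> \<open>The swapped singularities go by reversal: a singular \<open>(s, z, y)\<close> at
    level \<open>Suc m\<close> is mapped to \<open>(opp s, y, x)\<close> at level \<open>m\<close>,
    which is the swap of the starting pair.\<close>
  moreover have "(opp s, y, z) \<noteq> swap_pair q" if q: "q \<in> singular P n" for n q
  proof
    assume swap: "(opp s, y, z) = swap_pair q"
    then have q_eq: "q = (s, z, y)"
      by (cases q) auto
    show False
    proof (cases n)
      case 0
      then show False
        using q notin unfolding q_eq by simp
    next
      case (Suc m)
      then have "(opp s, y, x) \<in> singular P m"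
        using q billiard_map_reverse[OF _ map] assms unfolding q_eq p by simp
      then have "swap_pair (opp s, y, x) \<in> singular_set P"
        unfolding singular_set_def by blast
      then show False
        using nsing by simp
    qed
  qed
  ultimately have "(opp s, y, z) \<notin> singular_set P"
    unfolding singular_set_def by blast
  then show ?thesis
    using max map unfolding p phase_space_def by simp
qed

text \<open>The image still contains \<open>y\<close> and \<open>z\<close>, and the reversed step
  recovers \<open>x\<close> from them.\<close>

lemma inj_on_billiard_map: "inj_on (billiard_map P) (phase_space P)"
proof (rule inj_onI)
  fix p p'
  assume pp: "p \<in> phase_space P" "p' \<in> phase_space P" "billiard_map P p = billiard_map P p'"
  obtain s x y s' x' y' where p: "p = (s, x, y)" "p' = (s', x', y')"
    by (cases p, cases p')
  obtain z where z: "billiard_map P (s, x, y) = (opp s, y, z)"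
    by (simp add: billiard_map.simps)
  then have eq: "s' = s" "y' = y" "billiard_map P (s, x', y) = (opp s, y, z)"
    using pp(3) unfolding p by (auto simp: billiard_map.simps)
  have "billiard_map P (s, z, y) = (opp s, y, x)"
    using billiard_map_reverse[OF pp(1)[unfolded p(1)] z] .
  moreover have "billiard_map P (s, z, y) = (opp s, y, x')"
    using billiard_map_reverse[OF pp(2)[unfolded p(2) eq(1,2)] eq(3)] .
  ultimately show "p = p'"
    using p eq by simp
qed

end

subsection \<open>Residues of the three functionals\<close>

lemma funpow_cancel_inj_on:
  assumes "inj_on f S" "f ` S \<subseteq> S" "x \<in> S" "y \<in> S" "(f ^^ n) x = (f ^^ n) y"
  shows "x = y"
proof -
  have in_S: "(f ^^ m) w \<in> S" if "w \<in> S" for m w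
    using that assms(2) by (induction m) auto
  show ?thesis
    using assms(5)
  proof (induction n)
    case (Suc n)
    then show ?case
      using inj_onD[OF assms(1) _ in_S[OF assms(3)] in_S[OF assms(4)]] by simp
  qed simp
qed

text \<open>Two of the \<open>card Q + 1\<close> iterates with exponents 0 to \<open>card Q\<close>
  coincide; injectivity cancels their common initial part, so the return is to \<open>x\<close>
  itself.\<close>

lemma periodic_point_in_finite_set:
  assumes "inj_on f S" "f ` S \<subseteq> S" "finite Q" "f ` (S \<inter> Q) \<subseteq> Q" "x \<in> S \<inter> Q"
  obtains n where "1 \<le> n" "n \<le> card Q" "(f ^^ n) x = x"
proof -
  have orbit: "(f ^^ m) x \<in> S \<inter> Q" for m
    using assms(2,4,5) by (induction m) auto
  have "card ((\<lambda>m. (f ^^ m) x) ` {..card Q}) \<le> card Q"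
    using orbit assms(3) by (intro card_mono) auto
  then have "\<not> inj_on (\<lambda>m. (f ^^ m) x) {..card Q}"
    by (intro pigeonhole) simp
  then obtain i j where ij: "i < j" "j \<le> card Q" "(f ^^ i) x = (f ^^ j) x"
    unfolding inj_on_def by (metis atMost_iff linorder_neqE_nat)
  then have "(f ^^ i) x = (f ^^ i) ((f ^^ (j - i)) x)"
    by (metis comp_apply funpow_add le_add_diff_inverse less_imp_le_nat)
  then have "x = (f ^^ (j - i)) x"
    using funpow_cancel_inj_on[OF assms(1,2)] assms(5) orbit by blast
  then show thesis
    using that[of "j - i"] ij by simp
qed

definition residue_values :: "real \<Rightarrow> real set" where
  "residue_values t = {of_int a + of_int e * t |a e. e \<in> {-1, 0, 1}}"

lemma Ints_in_residue_values: "r \<in> \<int> \<Longrightarrow> r \<in> residue_values t"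
  unfolding residue_values_def by (elim Ints_cases) force

lemma self_in_residue_values: "t \<in> residue_values t"
proof -
  have "t = of_int 0 + of_int 1 * t" "1 \<in> {-1, 0, 1 :: int}"
    by simp_all
  then show ?thesis
    unfolding residue_values_def by blast
qed

text \<open>The value of the third functional has this shape: \<open>r\<close> is preserved along
  the chord, and \<open>q\<close> is the integer value on the edge that is hit.\<close>

lemma residue_values_neg_add_Ints:
  assumes "r \<in> residue_values t" "q \<in> \<int>"
  shows "- (r + q) \<in> residue_values t"
proof -
  obtain a e b where "r = of_int a + of_int e * t" "e \<in> {-1, 0, 1}" "q = of_int b"
    using assms unfolding residue_values_def by (blast elim: Ints_cases)
  then have "- (r + q) = of_int (- a - b) + of_int (- e) * t" "- e \<in> {-1, 0, 1}"
    by auto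
  then show ?thesis
    unfolding residue_values_def by blast
qed

text \<open>If both \<open>t\<close> and the value are at most \<open>M\<close> in modulus, the
  integer part \<open>a\<close> is at most \<open>2 * M\<close> in modulus. The resulting count does
  not involve \<open>t\<close>.\<close>

lemma card_residue_values:
  assumes "\<bar>t\<bar> \<le> of_int M"
  shows "finite (residue_values t \<inter> {- of_int M..of_int M})"
    and "card (residue_values t \<inter> {- of_int M..of_int M}) \<le> card ({-2 * M..2 * M} \<times> {-1, 0, 1 :: int})"
proof -
  let ?f = "\<lambda>(a, e). of_int a + of_int e * t"
  have "residue_values t \<inter> {- of_int M..of_int M} \<subseteq> ?f ` ({-2 * M..2 * M} \<times> {-1, 0, 1})"
  proof
    fix r assume "r \<in> residue_values t \<inter> {- of_int M..of_int M}"
    then obtain a e where ae: "r = of_int a + of_int e * t" "e \<in> {-1, 0, 1}"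
      and r: "- of_int M \<le> r" "r \<le> of_int M"
      unfolding residue_values_def by auto
    have "\<bar>of_int e * t\<bar> \<le> of_int M"
      using ae(2) assms by auto
    then have "real_of_int a \<le> of_int (2 * M)" "real_of_int (-2 * M) \<le> of_int a"
      using ae(1) r by simp_all
    then have "a \<le> 2 * M" "-2 * M \<le> a"
      unfolding of_int_le_iff by blast+
    then have "(a, e) \<in> {-2 * M..2 * M} \<times> {-1, 0, 1}"
      using ae(2) by auto
    then show "r \<in> ?f ` ({-2 * M..2 * M} \<times> {-1, 0, 1})"
      using ae(1) by force
  qed
  moreover have "finite ({-2 * M..2 * M} \<times> {-1, 0, 1 :: int})"
    by simp
  ultimately show "finite (residue_values t \<inter> {- of_int M..of_int M})"
    "card (residue_values t \<inter> {- of_int M..of_int M}) \<le> card ({-2 * M..2 * M} \<times> {-1, 0, 1 :: int})"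
    by (blast intro: finite_subset finite_imageI surj_card_le)+
qed

section \<open>Integer functionals with prescribed kernels\<close>

lemma det2_Ints:
  assumes "\<And>i. u $ i \<in> \<int>" "\<And>i. v $ i \<in> \<int>"
  shows "det2 u v \<in> \<int>"
  unfolding det2_def using assms by (intro Ints_diff Ints_mult)

text \<open>The linear dependence of three plane vectors with their 2x2 minors as coefficients
  (Cramer's rule), paired with \<open>p\<close>.\<close>

lemma three_det2: "det2 v w * det2 u p + det2 w u * det2 v p + det2 u v * det2 w p = 0"
  unfolding det2_def by algebra

lemma obtain_three_integer_functionals:
  fixes D :: "(real^2) set set"
  assumes "finite D" "card D \<le> 3"
    and dirs: "\<And>L. L \<in> D \<Longrightarrow> \<exists>u. u \<noteq> 0 \<and> (\<forall>i. u $ i \<in> \<int>) \<and> L = span {u}"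
    and L: "L1 \<in> D" "L2 \<in> D" "L1 \<noteq> L2"
  obtains l :: "nat \<Rightarrow> real^2 \<Rightarrow> real" where
    "\<forall>m. linear (l m)" "\<forall>p. l 0 p + l 1 p + l 2 p = 0"
    "\<forall>m p. (\<forall>i. p $ i \<in> \<int>) \<longrightarrow> l m p \<in> \<int>"
    "\<forall>p. l 0 p = 0 \<longrightarrow> l 1 p = 0 \<longrightarrow> p = 0"
    "\<forall>L\<in>D. \<exists>m<3. L = {p. l m p = 0}"
proof -
  obtain u where u: "u \<noteq> 0" "\<And>i. u $ i \<in> \<int>" "L1 = span {u}"
    using dirs[OF L(1)] by blast
  obtain v where v: "v \<noteq> 0" "\<And>i. v $ i \<in> \<int>" "L2 = span {v}"
    using dirs[OF L(2)] by blast
  have indep: "det2 a b \<noteq> 0" if "a \<noteq> 0" "b \<noteq> 0" "span {a} \<noteq> span {b}" for a b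
    using that span_singleton_eqI[of b a] span_eq_det2[of a] by auto
  have uv: "det2 u v \<noteq> 0"
    using indep u v L(3) by blast
  obtain w where w: "w \<noteq> 0" "\<And>i. w $ i \<in> \<int>" "D \<subseteq> {L1, L2, span {w}}"
    "det2 v w \<noteq> 0" "det2 w u \<noteq> 0"
  proof (cases "D \<subseteq> {L1, L2}")
    case True
    \<comment> \<open>With only two directions a third one is invented: \<open>u + v\<close> is
      integral and parallel to neither \<open>u\<close> nor \<open>v\<close>.\<close>
    have "det2 v (u + v) \<noteq> 0" "det2 (u + v) u \<noteq> 0"
      using uv by (simp_all add: det2_def algebra_simps)
    moreover from this have "u + v \<noteq> 0"
      using linear_0[OF linear_det2, of v] by metis
    moreover have "(u + v) $ i \<in> \<int>" for i
      using u(2) v(2) by simp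
    ultimately show thesis
      using that[of "u + v"] True by blast
  next
    case False
    then obtain L3 where L3: "L3 \<in> D" "L3 \<noteq> L1" "L3 \<noteq> L2"
      by blast
    then obtain w where w: "w \<noteq> 0" "\<And>i. w $ i \<in> \<int>" "L3 = span {w}"
      using dirs by blast
    have "card {L1, L2, L3} = 3"
      using L3 L(3) by auto
    then have "{L1, L2, L3} = D"
      using assms(1,2) L L3(1) by (intro card_seteq) auto
    moreover have "det2 v w \<noteq> 0" "det2 w u \<noteq> 0"
      using indep u v w L3 by metis+
    ultimately show thesis
      using that w by blast
  qed
  \<comment> \<open>The coefficients come from \<open>three_det2\<close>. They make the sum vanish,
    are nonzero, so the kernels stay the given lines, and are integers, so integrality
    survives.\<close>
  define l where "l = (\<lambda>(m::nat) p. if m = 0 then det2 v w * det2 u p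
    else if m = 1 then det2 w u * det2 v p else det2 u v * det2 w p)"
  show thesis
  proof (rule that[of l]; intro allI impI ballI)
    show "linear (l m)" for m
      unfolding l_def by (auto intro!: linearI simp: det2_add det2_scaleR algebra_simps)
    show "l 0 p + l 1 p + l 2 p = 0" for p
      using three_det2[of v w u p] by (simp add: l_def)
    show "l m p \<in> \<int>" if "\<forall>i. p $ i \<in> \<int>" for m p
      using that u(2) v(2) w(2) by (simp add: l_def det2_Ints Ints_mult)
    show "p = 0" if "l 0 p = 0" "l 1 p = 0" for p
    proof (rule ccontr)
      assume "p \<noteq> 0"
      moreover have "p \<in> span {u}" "p \<in> span {v}"
        using that w span_eq_det2 u v by (auto simp: l_def)
      ultimately show False
        using span_singleton_eqI[of p] u(3) v(3) L(3) by metis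
    qed
    show "\<exists>m<3. L = {p. l m p = 0}" if "L \<in> D" for L
    proof -
      have "L1 = {p. l 0 p = 0}" "L2 = {p. l 1 p = 0}" "span {w} = {p. l 2 p = 0}"
        using u v w uv span_eq_det2 by (auto simp: l_def)
      moreover have "(0::nat) < 3" "(1::nat) < 3" "(2::nat) < 3"
        by simp_all
      ultimately show ?thesis
        using that w(3) by blast
    qed
  qed
qed

section \<open>Confinement of orbits to finite sets\<close>

locale lattice_billiard = polygon_pair P for P :: "side \<Rightarrow> (real^2) list" +
  fixes l :: "nat \<Rightarrow> real^2 \<Rightarrow> real"
  assumes vertices_Ints: "\<And>s v i. v \<in> set (P s) \<Longrightarrow> v $ i \<in> \<int>"
    and linear_l: "\<And>m. linear (l m)"
    and l_sum: "\<And>p. l 0 p + l 1 p + l 2 p = 0"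
    and l_Ints: "\<And>m p. (\<And>i. p $ i \<in> \<int>) \<Longrightarrow> l m p \<in> \<int>"
    and l_separating: "\<And>p. l 0 p = 0 \<Longrightarrow> l 1 p = 0 \<Longrightarrow> p = 0"
    and edge_line_kernel: "\<And>s i. i < length (P s) \<Longrightarrow> \<exists>m<3. edge_line (P s) i = {p. l m p = 0}"
begin

text \<open>The two polygons are pooled, so that one set serves for both entries of a pair and for
  both sides.\<close>

definition residue_points :: "real \<Rightarrow> (real^2) set" where
  "residue_points t = {x \<in> (\<Union>s. polygon (P s)). \<forall>m<3. l m x \<in> residue_values t}"

lemma l_third:
  assumes "m < 3" "k < 3" "m \<noteq> k" "n < 3" "n \<noteq> m" "n \<noteq> k"
  shows "l n p = - (l m p + l k p)"
proof -
  have "{m, k, n} = {0, 1, 2}"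
    using assms by auto
  then have "(\<Sum>i\<in>{m, k, n}. l i p) = 0"
    using l_sum[of p] by simp
  then show ?thesis
    using assms by simp
qed

lemma edge_l_Ints:
  assumes "i < length (P s)" "x \<in> edge (P s) i" "edge_line (P s) i = {p. l m p = 0}"
  shows "l m x \<in> \<int>"
proof -
  let ?v = "vert (P s) i"
  have "x - ?v \<in> edge_line (P s) i"
    using assms(2) by (intro edge_diff_in_edge_line) (auto simp: closed_segment_eq_edge)
  then have "l m x = l m ?v"
    using assms(3) linear_diff[OF linear_l] by simp
  moreover have "?v \<in> set (P s)"
    using assms(1) by (intro vert_in_set) auto
  ultimately show ?thesis
    using l_Ints vertices_Ints by metis
qed

text \<open>Any functional other than the one constant on the edge of \<open>x\<close> can supply
  the parameter: the constant one is an integer there, and the third is minus the sum of these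
  two.\<close>

lemma residue_points_exists:
  assumes "i < length (P s)" "x \<in> edge (P s) i"
  obtains m where "x \<in> residue_points (l m x)" "m < 3"
proof -
  obtain k where k: "k < 3" "edge_line (P s) i = {p. l k p = 0}"
    using edge_line_kernel assms(1) by blast
  then have int: "l k x \<in> \<int>"
    using edge_l_Ints assms by blast
  obtain m :: nat where m: "m < 3" "m \<noteq> k"
    by (cases "k = 0") (auto intro: that[of 0] that[of 1])
  have "l n x \<in> residue_values (l m x)" if "n < 3" for n
  proof -
    consider "n = k" | "n = m" | "n \<noteq> k" "n \<noteq> m"
      by blast
    then show ?thesis
    proof cases
      case 3
      then show ?thesis
        using l_third[OF m(1) k(1) m(2) that] int self_in_residue_values
          residue_values_neg_add_Ints by simp
    qed (use int Ints_in_residue_values self_in_residue_values in auto)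
  qed
  moreover have "x \<in> polygon (P s)"
    using edge_subset_polygon assms by blast
  ultimately show thesis
    using that[of m] m(1) unfolding residue_points_def by blast
qed

lemma residue_points_step:
  assumes "(s, x, y) \<in> phase_space P" "billiard_map P (s, x, y) = (opp s, y, z)"
    and "x \<in> residue_points t"
  shows "z \<in> residue_points t"
proof -
  obtain i j k z' where "i < length (P s)" "x \<in> edge (P s) i"
    and jk': "j < length (P (opp s))" "y \<in> edge (P (opp s)) j" "k < length (P s)" "z' \<in> edge (P s) k"
    and "hits P (s, x, y) z'" and map: "billiard_map P (s, x, y) = (opp s, y, z')"
    and zx': "z' - x \<in> edge_line (P (opp s)) j"
    and ne: "edge_line (P s) k \<noteq> edge_line (P (opp s)) j"
    by (rule phase_space_step[OF assms(1)])
  have "z' = z"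
    using assms(2) map by (metis prod.inject)
  note jk = jk'(1,3,4)[unfolded this] and zx = zx'[unfolded this]
  obtain mj where mj: "mj < 3" "edge_line (P (opp s)) j = {p. l mj p = 0}"
    using edge_line_kernel jk(1) by blast
  obtain mk where mk: "mk < 3" "edge_line (P s) k = {p. l mk p = 0}"
    using edge_line_kernel jk(2) by blast
  \<comment> \<open>Transversality at \<open>z\<close> enters here: the functional that carries the
    residue and the one that is integral are different, so together they determine the
    third.\<close>
  have m_ne: "mj \<noteq> mk"
    using ne mj mk by metis
  have "l mj z = l mj x"
    using zx mj(2) linear_diff[OF linear_l] by simp
  then have res: "l mj z \<in> residue_values t"
    using assms(3) mj(1) by (simp add: residue_points_def)
  have int: "l mk z \<in> \<int>"
    using edge_l_Ints[OF jk(2,3) mk(2)] .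
  have "l n z \<in> residue_values t" if "n < 3" for n
  proof -
    consider "n = mj" | "n = mk" | "n \<noteq> mj" "n \<noteq> mk"
      by blast
    then show ?thesis
    proof cases
      case 3
      then show ?thesis
        using l_third[OF mj(1) mk(1) m_ne that] residue_values_neg_add_Ints[OF res int] by simp
    qed (use res int Ints_in_residue_values in auto)
  qed
  moreover have "z \<in> polygon (P s)"
    using edge_subset_polygon jk by blast
  ultimately show ?thesis
    unfolding residue_points_def by blast
qed

lemma l_bounded:
  obtains M :: int where "\<And>m x. m < 3 \<Longrightarrow> x \<in> (\<Union>s. polygon (P s)) \<Longrightarrow> \<bar>l m x\<bar> \<le> of_int M"
proof -
  define K where "K = (\<Union>s. polygon (P s))"
  have UNIV_side: "(UNIV :: side set) = {Side_minus, Side_plus}"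
    by (auto intro: side.exhaust)
  have poly: "bounded (polygon (P s))" for s
    using polygon_topology(1)[OF polygons] by (rule compact_imp_bounded)
  have "bounded K"
    unfolding K_def UNIV_side using poly by simp
  then have "bounded (l m ` K)" for m
    using linear_l[of m] unfolding linear_conv_bounded_linear by (rule bounded_linear_image)
  then have "bounded (\<Union>m<3. l m ` K)"
    by (intro bounded_UN) simp_all
  then obtain B where B: "\<And>r. r \<in> (\<Union>m<3. l m ` K) \<Longrightarrow> norm r \<le> B"
    unfolding bounded_iff by blast
  have "\<bar>l m x\<bar> \<le> of_int \<lceil>B\<rceil>" if "m < 3" "x \<in> K" for m x
  proof -
    have "\<bar>l m x\<bar> \<le> B"
      using B[of "l m x"] that by auto
    then show ?thesis
      using le_of_int_ceiling[of B] by linarith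
  qed
  then show thesis
    by (intro that[of "\<lceil>B\<rceil>"]) (simp add: K_def)
qed

text \<open>The values of \<open>l 0\<close> and \<open>l 1\<close> determine the point, which gives
  a product bound. Parameters of the form \<open>l m x\<close> are themselves bounded by
  \<open>M\<close>, so \<open>N\<close> can be chosen before the orbit.\<close>

lemma card_residue_points:
  obtains N where "\<And>m x. m < 3 \<Longrightarrow> x \<in> (\<Union>s. polygon (P s)) \<Longrightarrow>
    finite (residue_points (l m x)) \<and> card (residue_points (l m x)) \<le> N"
proof -
  obtain M where M: "\<And>m x. m < 3 \<Longrightarrow> x \<in> (\<Union>s. polygon (P s)) \<Longrightarrow> \<bar>l m x\<bar> \<le> of_int M"
    using l_bounded by blast
  define C where "C = card ({-2 * M..2 * M} \<times> {-1, 0, 1 :: int})"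
  have "finite (residue_points t) \<and> card (residue_points t) \<le> C * C" if "\<bar>t\<bar> \<le> of_int M" for t
  proof -
    let ?R = "residue_values t \<inter> {- of_int M..of_int M}"
    let ?f = "\<lambda>x. (l 0 x, l 1 x)"
    have inj: "inj_on ?f (residue_points t)"
    proof (rule inj_onI)
      fix x y assume "?f x = ?f y"
      then have "l 0 (x - y) = 0" "l 1 (x - y) = 0"
        using linear_diff[OF linear_l] by simp_all
      then show "x = y"
        using l_separating[of "x - y"] by simp
    qed
    have image: "?f ` residue_points t \<subseteq> ?R \<times> ?R"
    proof
      fix q assume "q \<in> ?f ` residue_points t"
      then obtain x where x: "x \<in> residue_points t" "q = (l 0 x, l 1 x)"
        by blast
      have "l m x \<in> ?R" if "m < 3" for m
        using x(1) M[OF that, of x] that unfolding residue_points_def by (simp add: abs_le_iff)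
      from this[of 0] this[of 1] show "q \<in> ?R \<times> ?R"
        using x(2) by simp
    qed
    have fin: "finite (?R \<times> ?R)"
      using card_residue_values(1)[OF that] by blast
    have "card (?R \<times> ?R) \<le> C * C"
      using card_residue_values(2)[OF that] unfolding card_cartesian_product C_def by (intro mult_le_mono)
    then have "card (residue_points t) \<le> C * C"
      using card_inj_on_le[OF inj image fin] by (rule order_trans[rotated])
    then show ?thesis
      using inj_on_finite[OF inj image fin] by blast
  qed
  note bound = this
  show thesis
    by (rule that[of "C * C"], rule bound, rule M)
qed

lemma bounded_periods:
  "\<exists>B. \<forall>p\<in>phase_space P. \<exists>n\<ge>1. n \<le> B \<and> (billiard_map P ^^ n) p = p"
proof -
  obtain N where N: "\<And>m x. m < 3 \<Longrightarrow> x \<in> (\<Union>s. polygon (P s)) \<Longrightarrow>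
    finite (residue_points (l m x)) \<and> card (residue_points (l m x)) \<le> N"
    using card_residue_points by blast
  \<comment> \<open>The factor 2 counts the sides; each entry of a pair ranges over two residue sets
    of at most \<open>N\<close> points.\<close>
  have "\<exists>n\<ge>1. n \<le> 2 * ((N + N) * (N + N)) \<and> (billiard_map P ^^ n) p = p"
    if p: "p \<in> phase_space P" for p
  proof -
    obtain s x y where p_eq: "p = (s, x, y)"
      by (cases p)
    obtain i j where ij: "i < length (P s)" "x \<in> edge (P s) i"
      "j < length (P (opp s))" "y \<in> edge (P (opp s)) j"
      by (rule phase_space_step[OF p[unfolded p_eq]])
    obtain m where m: "x \<in> residue_points (l m x)" "m < 3"
      using residue_points_exists[OF ij(1,2)] by blast
    obtain n where n: "y \<in> residue_points (l n y)" "n < 3"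
      using residue_points_exists[OF ij(3,4)] by blast
    \<comment> \<open>The parameters of \<open>x\<close> and \<open>y\<close> are unrelated. Each
      later point inherits the parameter of the point two places before it, so it stays in the
      union.\<close>
    define G where "G = residue_points (l m x) \<union> residue_points (l n y)"
    have "x \<in> (\<Union>s. polygon (P s))" "y \<in> (\<Union>s. polygon (P s))"
      using m n unfolding residue_points_def by blast+
    then have fin: "finite (residue_points (l m x))" "card (residue_points (l m x)) \<le> N"
      "finite (residue_points (l n y))" "card (residue_points (l n y)) \<le> N"
      using N[OF m(2)] N[OF n(2)] by blast+
    then have G: "finite G" "card G \<le> N + N"
      using card_Un_le[of "residue_points (l m x)" "residue_points (l n y)"]
      unfolding G_def by simp_all
    define Q where "Q = {Side_minus, Side_plus} \<times> G \<times> G"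
    have "card Q = 2 * (card G * card G)"
      unfolding Q_def card_cartesian_product by simp
    then have Q: "finite Q" "card Q \<le> 2 * ((N + N) * (N + N))"
      using G mult_le_mono[OF G(2) G(2)] by (simp_all add: Q_def)
    have "billiard_map P ` (phase_space P \<inter> Q) \<subseteq> Q"
    proof
      fix q assume "q \<in> billiard_map P ` (phase_space P \<inter> Q)"
      then obtain p' where p': "p' \<in> phase_space P" "p' \<in> Q" "q = billiard_map P p'"
        by blast
      obtain s x y where "p' = (s, x, y)"
        by (cases p')
      note sxy = p'[unfolded this]
      obtain z where z: "billiard_map P (s, x, y) = (opp s, y, z)"
        by (simp add: billiard_map.simps)
      have xy: "x \<in> G" "y \<in> G"
        using sxy(2) unfolding Q_def by blast+
      then have "z \<in> G"
        using residue_points_step[OF sxy(1) z] unfolding G_def by blast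
      then show "q \<in> Q"
        using xy(2) unfolding sxy(3) z Q_def by (cases s) auto
    qed
    moreover have "p \<in> phase_space P \<inter> Q"
      using p m n unfolding p_eq Q_def G_def by (cases s) auto
    moreover have "billiard_map P ` phase_space P \<subseteq> phase_space P"
      using billiard_map_phase_space by blast
    ultimately obtain k where k: "1 \<le> k" "k \<le> card Q" "(billiard_map P ^^ k) p = p"
      using periodic_point_in_finite_set[OF inj_on_billiard_map _ Q(1)] by blast
    then show ?thesis
      using order_trans[OF k(2) Q(2)] by blast
  qed
  then show ?thesis
    by blast
qed

end

text \<open>Supplies the two distinct directions from which
  \<open>obtain_three_integer_functionals\<close> starts; equal directions would make three
  consecutive vertices collinear.\<close>

lemma edge_line_consecutive_neq:
  assumes "polygon_vertices vs"
  shows "edge_line vs 0 \<noteq> edge_line vs 1"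
proof
  let ?u = "vert vs (Suc 0) - vert vs 0" and ?v = "vert vs (Suc (Suc 0)) - vert vs (Suc 0)"
  assume "edge_line vs 0 = edge_line vs 1"
  then have "?v \<in> span {?u}"
    unfolding edge_line_def by (metis One_nat_def span_base singletonI)
  then obtain c where "?v = c *\<^sub>R ?u"
    unfolding span_singleton by blast
  then have "vert vs (Suc (Suc 0)) - vert vs 0 = (c + 1) *\<^sub>R ?u"
    by (simp add: algebra_simps)
  then have "collinear {0, ?u, vert vs (Suc (Suc 0)) - vert vs 0}"
    unfolding collinear_lemma by blast
  \<comment> \<open>\<open>vert vs 0\<close> is put in the middle because \<open>collinear_3\<close>
    subtracts the middle point.\<close>
  then have "collinear {vert vs (Suc 0), vert vs 0, vert vs (Suc (Suc 0))}"
    by (subst collinear_3) simp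
  moreover have "0 < length vs"
    using assms unfolding polygon_vertices_def by linarith
  ultimately show False
    using assms unfolding polygon_vertices_def by (auto simp: insert_commute)
qed

theorem corollary3p3:
  fixes P :: "side \<Rightarrow> (real^2) list"
  assumes polygons: "\<And>s. polygon_vertices (P s)"
    and lattice: "\<And>s v i. v \<in> set (P s) \<Longrightarrow> v $ i \<in> \<int>"
    and directions: "card (tangent_directions (P Side_minus) \<union> tangent_directions (P Side_plus)) \<le> 3"
  shows "(\<forall>p\<in>phase_space P. periodic_orbit P p) \<and>
    (\<exists>B. \<forall>p\<in>phase_space P. orbit_period P p \<le> B)"
proof -
  let ?D = "tangent_directions (P Side_minus) \<union> tangent_directions (P Side_plus)"
  have in_D: "edge_line (P s) i \<in> ?D" if "i < length (P s)" for s i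
    using that by (cases s) (auto simp: tangent_directions_def)
  have fin: "finite ?D"
    by (simp add: tangent_directions_def)
  have dirs: "\<exists>u. u \<noteq> 0 \<and> (\<forall>i. u $ i \<in> \<int>) \<and> L = span {u}" if "L \<in> ?D" for L
  proof -
    obtain s where "L \<in> tangent_directions (P s)"
      using \<open>L \<in> ?D\<close> by blast
    then obtain i where si: "i < length (P s)" "L = edge_line (P s) i"
      by (auto simp: tangent_directions_def)
    let ?u = "vert (P s) (Suc i) - vert (P s) i"
    have "vert (P s) j \<in> set (P s)" for j
      using si(1) by (intro vert_in_set) auto
    then have "?u $ k \<in> \<int>" for k
      unfolding vector_minus_component by (intro Ints_diff lattice)
    moreover have "?u \<noteq> 0"
      using vert_neq_Suc[OF polygons si(1)] by simp
    ultimately show ?thesis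
      using si(2) unfolding edge_line_def by blast
  qed
  have "0 < length (P Side_minus)" "1 < length (P Side_minus)"
    using polygons[of Side_minus] unfolding polygon_vertices_def by linarith+
  then have L: "edge_line (P Side_minus) 0 \<in> ?D" "edge_line (P Side_minus) 1 \<in> ?D"
    using in_D by blast+
  obtain l :: "nat \<Rightarrow> real^2 \<Rightarrow> real" where l:
    "\<forall>m. linear (l m)" "\<forall>p. l 0 p + l 1 p + l 2 p = 0"
    "\<forall>m p. (\<forall>i. p $ i \<in> \<int>) \<longrightarrow> l m p \<in> \<int>"
    "\<forall>p. l 0 p = 0 \<longrightarrow> l 1 p = 0 \<longrightarrow> p = 0"
    "\<forall>L\<in>?D. \<exists>m<3. L = {p. l m p = 0}"
    by (rule obtain_three_integer_functionals
        [OF fin directions dirs L edge_line_consecutive_neq[OF polygons]])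
  interpret lattice_billiard P l
    by (intro lattice_billiard.intro polygon_pair.intro lattice_billiard_axioms.intro)
      (assumption | rule polygons lattice l(1-4)[rule_format] l(5)[rule_format, OF in_D])+
  obtain B where B: "\<And>p. p \<in> phase_space P \<Longrightarrow> \<exists>n\<ge>1. n \<le> B \<and> (billiard_map P ^^ n) p = p"
    using bounded_periods by metis
  show ?thesis
  proof (intro conjI ballI exI[of _ B])
    fix p assume "p \<in> phase_space P"
    then obtain n where n: "n \<ge> 1" "n \<le> B" "(billiard_map P ^^ n) p = p"
      using B by blast
    then show "periodic_orbit P p"
      unfolding periodic_orbit_def by blast
    have "orbit_period P p \<le> n"
      unfolding orbit_period_def using n by (intro Least_le) blast
    then show "orbit_period P p \<le> B"
      using n(2) by linarith
  qed
qed

end
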